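(* Let $p$ be a prime and $\lambda$ a partition. For every ideal $I$ of $P_\lambda$, $$|O_{p,I}|=\sum_{I-\max I\subset J\subset I}(-1)^{|I-J|}p^{[J]},$$ where the sum is over the ideals $J$ of $P_\lambda$ with $I-\max I\subset J\subset I$, and $-$ between sets denotes set difference.
   Context: A partition is a non-increasing sequence $\lambda=(\lambda_1\geq\cdots\geq\lambda_l)$ of positive integers. $A_{p,\lambda}=\mathbf{Z}/p^{\lambda_1}\mathbf{Z}\oplus\cdots\oplus\mathbf{Z}/p^{\lambda_l}\mathbf{Z}$ and $G_{p,\lambda}$ is its automorphism group. Fundamental poset $P$: its elements are the symbols $(p^r,k)$ with integers $0\leq r<k$, where $(p^r,k)$ stands for the orbit of $p^r$ in $\mathbf{Z}/p^k\mathbf{Z}$ under automorphisms of $\mathbf{Z}/p^k\mathbf{Z}$, i.e. the set of elements $p^ru$ with $p\nmid u$. The partial order is: $(p^r,k)\geq(p^s,l)$ if and only if $r\leq s$ and $k-r\geq l-s$ (equivalently, some homomorphism $\mathbf{Z}/p^k\mathbf{Z}\to\mathbf{Z}/p^l\mathbf{Z}$ maps $p^r$ to $p^s$). $P_\lambda$ is the induced subposet consisting of the elements $(p^r,k)$ with $k=\lambda_i$ for some $i$. An ideal of a poset is a (possibly empty) down-closed subset; $\max I$ is the set of maximal elements of $I$. For $a=(a_1,\ldots,a_l)\in A_{p,\lambda}$, $I(a)$ is the ideal of $P$ generated by the orbits of the non-zero coordinates $a_i\in\mathbf{Z}/p^{\lambda_i}\mathbf{Z}$ ($a_i=p^ru\neq0$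 with $p\nmid u$ contributes $(p^r,\lambda_i)$), and $I_\lambda(a)=I(a)\cap P_\lambda$. For an ideal $I$ of $P_\lambda$, $O_{p,I}=\{a\in A_{p,\lambda}: I_\lambda(a)=I\}$, which is the $G_{p,\lambda}$-orbit in $A_{p,\lambda}$ corresponding to $I$. For $x=(p^r,k)\in P_\lambda$, the multiplicity $m(x)$ is the number of times $k$ occurs in $\lambda$. For an ideal $J$ of $P_\lambda$, $[J]=\sum_{x\in J}m(x)$, while $|I-J|$ is the ordinary cardinality of the set $I-J$. *)

theory Defs
  imports "HOL-Computational_Algebra.Primes" "HOL-Algebra.Product_Groups"
    "HOL-Algebra.Elementary_Groups"
begin

definition is_partition :: "nat list \<Rightarrow> bool" where
  "is_partition lam \<longleftrightarrow> sorted_wrt (\<ge>) lam \<and> (\<forall>k\<in>set lam. 0 < k)"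

text \<open>The direct sum of the groups \<open>\<int>/p\<^sup>k\<int>\<close>, for \<open>k\<close> running through the parts of the partition.
  The index set is finite, so this is the direct product.  Coordinates are indexed from 0, and
  each coordinate is the representative in \<open>{0..<p ^ k}\<close> of its residue class.\<close>

definition abelian_p_group :: "nat \<Rightarrow> nat list \<Rightarrow> (nat \<Rightarrow> int) monoid" where
  "abelian_p_group p lam =
     product_group {..<length lam} (\<lambda>i. integer_mod_group (p ^ (lam ! i)))"

text \<open>The symbol \<open>(p\<^sup>r, k)\<close> is encoded as the pair \<open>(r, k)\<close>; neither the elements of the
  fundamental poset nor its order depend on \<open>p\<close>.\<close>

definition fund_poset :: "(nat \<times> nat) set" where
  "fund_poset = {(r, k). r < k}"

text \<open>Only meant for elements of \<^const>\<open>fund_poset\<close>, where the subtractions do not truncate.\<close>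

definition fund_le :: "nat \<times> nat \<Rightarrow> nat \<times> nat \<Rightarrow> bool" where
  "fund_le y x \<longleftrightarrow> fst x \<le> fst y \<and> snd x - fst x \<ge> snd y - fst y"

definition fund_poset_of :: "nat list \<Rightarrow> (nat \<times> nat) set" where
  "fund_poset_of lam = {x \<in> fund_poset. snd x \<in> set lam}"

definition order_ideal :: "(nat \<times> nat) set \<Rightarrow> (nat \<times> nat) set \<Rightarrow> bool" where
  "order_ideal P J \<longleftrightarrow> J \<subseteq> P \<and> (\<forall>x\<in>J. \<forall>y\<in>P. fund_le y x \<longrightarrow> y \<in> J)"

definition generated_ideal :: "(nat \<times> nat) set \<Rightarrow> (nat \<times> nat) set" where
  "generated_ideal S = {y \<in> fund_poset. \<exists>x\<in>S. fund_le y x}"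

definition max_elems :: "(nat \<times> nat) set \<Rightarrow> (nat \<times> nat) set" where
  "max_elems J = {x \<in> J. \<forall>y\<in>J. fund_le x y \<longrightarrow> y = x}"

text \<open>Since \<open>0 < a i < p ^ (lam ! i)\<close> for a non-zero coordinate, \<open>r < lam ! i\<close> is automatic, and
  reading \<open>a i = p\<^sup>r u\<close> in the integers or modulo \<open>p ^ (lam ! i)\<close> determines the same \<open>r\<close>.\<close>

definition coord_orbits :: "nat \<Rightarrow> nat list \<Rightarrow> (nat \<Rightarrow> int) \<Rightarrow> (nat \<times> nat) set" where
  "coord_orbits p lam a =
     {(r, lam ! i) | r i. i < length lam \<and> a i \<noteq> 0 \<and>
        (\<exists>u. \<not> int p dvd u \<and> a i = int p ^ r * u)}"

definition elem_ideal :: "nat \<Rightarrow> nat list \<Rightarrow> (nat \<Rightarrow> int) \<Rightarrow> (nat \<times> nat) set" where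
  "elem_ideal p lam a = generated_ideal (coord_orbits p lam a)"

definition elem_ideal_of :: "nat \<Rightarrow> nat list \<Rightarrow> (nat \<Rightarrow> int) \<Rightarrow> (nat \<times> nat) set" where
  "elem_ideal_of p lam a = elem_ideal p lam a \<inter> fund_poset_of lam"

definition ideal_orbit :: "nat \<Rightarrow> nat list \<Rightarrow> (nat \<times> nat) set \<Rightarrow> (nat \<Rightarrow> int) set" where
  "ideal_orbit p lam I = {a \<in> carrier (abelian_p_group p lam). elem_ideal_of p lam a = I}"

definition part_mult :: "nat list \<Rightarrow> nat \<times> nat \<Rightarrow> nat" where
  "part_mult lam x = count_list lam (snd x)"

definition weight :: "nat list \<Rightarrow> (nat \<times> nat) set \<Rightarrow> nat" where
  "weight lam J = (\<Sum>x\<in>J. part_mult lam x)"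

end

theory Submission
  imports Defs
begin

text \<open>For an ideal \<open>J\<close> the elements \<open>a\<close> with \<open>I\<^sub>\<lambda>(a) \<subseteq> J\<close> form a subgroup that is a product of
  subgroups \<open>p\<^bsup>k - n\<^esup>\<int>/p\<^sup>k\<int>\<close>, where \<open>n\<close> is the number of \<open>r\<close> with \<open>(p\<^sup>r, k) \<in> J\<close>; so there are
  \<open>p\<^bsup>[J]\<^esup>\<close> of them.  The ideals between \<open>I - max I\<close> and \<open>I\<close> are the sets \<open>I - S\<close> with
  \<open>S \<subseteq> max I\<close>, and \<open>I\<^sub>\<lambda>(a) = I\<close> means that \<open>I\<^sub>\<lambda>(a) \<subseteq> I\<close> misses no element of \<open>max I\<close>.  The
  formula is therefore inclusion-exclusion over the subsets of \<open>max I\<close>.\<close>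

section \<open>The order on the fundamental poset\<close>

lemma fund_le_refl: "fund_le x x"
  by (simp add: fund_le_def)

lemma fund_le_trans: "fund_le x y \<Longrightarrow> fund_le y z \<Longrightarrow> fund_le x z"
  by (auto simp: fund_le_def)

lemma fund_le_antisym:
  assumes "fund_le x y" "fund_le y x" "x \<in> fund_poset" "y \<in> fund_poset"
  shows "x = y"
  using assms by (auto simp: fund_le_def fund_poset_def prod_eq_iff)

lemma finite_fund_poset_of: "finite (fund_poset_of lam)"
proof -
  have "fund_poset_of lam \<subseteq> (\<Union>k\<in>set lam. {..<k} \<times> {k})"
    by (auto simp: fund_poset_of_def fund_poset_def)
  thus ?thesis
    by (rule finite_subset) auto
qed

text \<open>A non-maximal \<open>x\<close> lies below some \<open>y \<noteq> x\<close> in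
  \<open>J\<close>. Fewer elements lie above \<open>y\<close> than above \<open>x\<close>, since
  antisymmetry excludes \<open>x\<close> itself, so the climb ends.\<close>

lemma exists_max_elem_above:
  assumes "finite J" "J \<subseteq> fund_poset" "x \<in> J"
  shows "\<exists>m\<in>max_elems J. fund_le x m"
  using assms(3)
proof (induction "card {y \<in> J. fund_le x y}" arbitrary: x rule: less_induct)
  case (less x)
  show ?case
  proof (cases "x \<in> max_elems J")
    case True
    thus ?thesis using fund_le_refl by blast
  next
    case False
    then obtain y where y: "y \<in> J" "fund_le x y" "y \<noteq> x"
      using less.prems by (auto simp: max_elems_def)
    have "x \<notin> {z \<in> J. fund_le y z}"
      using fund_le_antisym[of x y] y less.prems assms(2) by auto
    moreover have "x \<in> {z \<in> J. fund_le x z}"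
      using less.prems fund_le_refl by simp
    moreover have "{z \<in> J. fund_le y z} \<subseteq> {z \<in> J. fund_le x z}"
      using y fund_le_trans by blast
    ultimately have "card {z \<in> J. fund_le y z} < card {z \<in> J. fund_le x z}"
      using assms(1) by (intro psubset_card_mono) auto
    with less.hyps y show ?thesis
      using fund_le_trans by blast
  qed
qed

section \<open>Ideals, their maximal elements, and alternating sums\<close>

lemma order_ideal_eq_iff_max_elems_subset:
  assumes "order_ideal (fund_poset_of lam) I" "order_ideal (fund_poset_of lam) J" "J \<subseteq> I"
  shows "J = I \<longleftrightarrow> max_elems I \<subseteq> J"
proof
  assume max: "max_elems I \<subseteq> J"
  have sub: "I \<subseteq> fund_poset_of lam"
    using assms(1) by (simp add: order_ideal_def)
  hence fin: "finite I" "I \<subseteq> fund_poset"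
    using finite_fund_poset_of finite_subset by (auto simp: fund_poset_of_def)
  \<comment> \<open>A finite ideal is the down-closure of its maximal elements, and \<open>J\<close>
    is down-closed.\<close>
  have "x \<in> J" if x: "x \<in> I" for x
  proof -
    obtain m where "m \<in> max_elems I" "fund_le x m"
      using exists_max_elem_above[OF fin x] by blast
    with max sub x assms(2) show ?thesis
      unfolding order_ideal_def by blast
  qed
  with assms(3) show "J = I" by blast
qed (auto simp: max_elems_def)

text \<open>By maximality an element of \<open>S\<close> lies below no other element of
  \<open>I\<close>, so removing it cannot break down-closure.\<close>

lemma order_ideal_diff_max_elems:
  assumes "order_ideal P I" "S \<subseteq> max_elems I"
  shows "order_ideal P (I - S)"
  using assms unfolding order_ideal_def max_elems_def by blast

lemma bij_betw_ideals_Pow_max_elems: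
  assumes "order_ideal P I"
  shows "bij_betw (\<lambda>S. I - S) (Pow (max_elems I))
           {J. order_ideal P J \<and> I - max_elems I \<subseteq> J \<and> J \<subseteq> I}"
\<comment> \<open>Complementation within \<open>I\<close> undoes itself, so the inverse has the same
  form.\<close>
proof (rule bij_betw_byWitness[where f' = "\<lambda>J. I - J"])
  show "(\<lambda>S. I - S) ` Pow (max_elems I) \<subseteq>
      {J. order_ideal P J \<and> I - max_elems I \<subseteq> J \<and> J \<subseteq> I}"
    using order_ideal_diff_max_elems[OF assms] by auto
qed (auto simp: max_elems_def)

text \<open>Expanding a product of \<open>card A\<close> factors \<open>1 - 1\<close> gives this
  sum; \<open>0 ^ 0 = 1\<close> accounts for the empty set.\<close>

lemma sum_alternating_Pow:
  assumes "finite A"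
  shows "(\<Sum>S\<in>Pow A. (-1) ^ card S) = (of_bool (A = {}) :: 'a :: comm_ring_1)"
proof -
  have "(\<Sum>S\<in>Pow A. (-1) ^ card S) = (0 :: 'a) ^ card A"
    using prod_diff_conv_sum[OF assms, of "\<lambda>_. 1 :: 'a" "\<lambda>_. 1"] by simp
  thus ?thesis
    using assms by (simp add: power_0_left)
qed

section \<open>The ideal attached to a group element\<close>

lemma order_ideal_elem_ideal_of: "order_ideal (fund_poset_of lam) (elem_ideal_of p lam a)"
  unfolding order_ideal_def elem_ideal_of_def elem_ideal_def generated_ideal_def
  by (auto simp: fund_poset_of_def intro: fund_le_trans)

lemma carrier_abelian_p_group:
  assumes "p > 0"
  shows "carrier (abelian_p_group p lam) = (\<Pi>\<^sub>E i\<in>{..<length lam}. {0..<int (p ^ (lam ! i))})"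
  using assms by (simp add: abelian_p_group_def carrier_integer_mod_group)

lemma coord_orbits_subset_fund_poset_of:
  assumes "prime p" "a \<in> carrier (abelian_p_group p lam)"
  shows "coord_orbits p lam a \<subseteq> fund_poset_of lam"
proof
  fix x assume "x \<in> coord_orbits p lam a"
  then obtain r i u where x: "x = (r, lam ! i)" "i < length lam" "a i \<noteq> 0" "a i = int p ^ r * u"
    by (auto simp: coord_orbits_def)
  have "a i \<in> {0..<int (p ^ (lam ! i))}"
    using PiE_mem[OF assms(2)[unfolded carrier_abelian_p_group[OF prime_gt_0_nat[OF assms(1)]]]] x(2)
    by simp
  hence a: "0 < a i" "a i < int p ^ (lam ! i)"
    using x(3) by auto
  have "int p ^ r \<le> a i"
    using a x(4) by (intro zdvd_imp_le) auto
  with a have "int p ^ r < int p ^ (lam ! i)" by linarith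
  hence "r < lam ! i"
    using prime_gt_1_nat[OF assms(1)] by simp
  with x show "x \<in> fund_poset_of lam"
    by (auto simp: fund_poset_of_def fund_poset_def)
qed

text \<open>The orbits generate the ideal and themselves lie in it, so testing them is enough. This
  replaces containment of ideals by a condition on each coordinate separately.\<close>

lemma elem_ideal_of_subset_iff:
  assumes "prime p" "a \<in> carrier (abelian_p_group p lam)" "order_ideal (fund_poset_of lam) J"
  shows "elem_ideal_of p lam a \<subseteq> J \<longleftrightarrow> coord_orbits p lam a \<subseteq> J"
proof -
  have "coord_orbits p lam a \<subseteq> elem_ideal_of p lam a"
    using coord_orbits_subset_fund_poset_of[OF assms(1,2)] fund_le_refl
    by (auto simp: elem_ideal_of_def elem_ideal_def generated_ideal_def fund_poset_of_def)
  moreover have "elem_ideal_of p lam a \<subseteq> J" if "coord_orbits p lam a \<subseteq> J"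
    using that assms(3)
    by (auto simp: order_ideal_def elem_ideal_of_def elem_ideal_def generated_ideal_def)
  ultimately show ?thesis by blast
qed

section \<open>Counting the elements whose ideal lies in a given ideal\<close>

lemma order_ideal_row:
  assumes "order_ideal (fund_poset_of lam) J" "k \<in> set lam"
  defines "n \<equiv> card {r. (r, k) \<in> J}"
  shows "n \<le> k" "{r. (r, k) \<in> J} = {k - n..<k}"
proof -
  define R where "R = {r. (r, k) \<in> J}"
  have R: "R \<subseteq> {..<k}"
    using assms(1) by (auto simp: R_def order_ideal_def fund_poset_of_def fund_poset_def)
  \<comment> \<open>For fixed \<open>k\<close> the order on the symbols \<open>(r, k)\<close>
    reverses that of the exponents, so an ideal meets the row in a final segment.\<close>
  have up: "s \<in> R" if "r \<in> R" "r \<le> s" "s < k" for r s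
    using assms that
    by (auto simp: R_def order_ideal_def fund_poset_of_def fund_poset_def fund_le_def)
  show "n \<le> k"
    using card_mono[OF _ R] by (simp add: n_def R_def)
  have "\<exists>m. R = {m..<k}"
  proof (cases "R = {}")
    case False
    have "finite R" using R finite_subset by blast
    with False have "Min R \<in> R" "\<And>r. r \<in> R \<Longrightarrow> Min R \<le> r"
      by simp_all
    hence "R = {Min R..<k}"
      using R up[of "Min R"] by (intro equalityI subsetI) auto
    thus ?thesis by blast
  \<comment> \<open>An empty row is the interval \<open>{k..<k}\<close>.\<close>
  qed (auto intro: exI[of _ k])
  then obtain m where "R = {m..<k}" by blast
  thus "{r. (r, k) \<in> J} = {k - n..<k}"
    \<comment> \<open>For \<open>m \<le> k\<close> the interval has \<open>k - m\<close> elements,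
      so \<open>k - n = m\<close>; for \<open>m > k\<close> both sides are empty.\<close>
    unfolding n_def R_def by (cases "m \<le> k") auto
qed

text \<open>These are the multiples of \<open>p ^ (k - n)\<close> among the representatives,
  parametrised by \<open>{0..<int (p ^ n)}\<close>; zero meets the condition vacuously. The
  factorisations \<open>p ^ r * u\<close> match those in \<open>coord_orbits\<close>.\<close>

lemma card_bounded_valuation:
  assumes "prime p" "n \<le> k"
  shows "card {x \<in> {0..<int (p ^ k)}.
           \<forall>r u. x \<noteq> 0 \<longrightarrow> \<not> int p dvd u \<longrightarrow> x = int p ^ r * u \<longrightarrow> r \<in> {k - n..<k}} = p ^ n"
    (is "card ?X = _")
proof -
  have p: "p > 1" "prime (int p)"
    using assms(1) prime_gt_1_nat by auto
  have split: "int (p ^ k) = int p ^ (k - n) * int (p ^ n)"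
    using assms(2) by (simp flip: power_add)
  have "?X = (\<lambda>y. int p ^ (k - n) * y) ` {0..<int (p ^ n)}"
  proof (intro equalityI subsetI)
    fix x assume x: "x \<in> ?X"
    have "int p ^ (k - n) dvd x"
    proof (cases "x = 0")
      case False
      have "x \<noteq> 0" "\<not> is_unit (int p)" using False p(1) by auto
      \<comment> \<open>The valuation of \<open>x\<close> is the exponent to which the condition
        defining \<open>?X\<close> is applied.\<close>
      then obtain u where u: "x = int p ^ multiplicity (int p) x * u" "\<not> int p dvd u"
        using multiplicity_decompose' by blast
      hence "k - n \<le> multiplicity (int p) x"
        using x False by auto
      thus ?thesis
        using multiplicity_dvd' by blast
    qed auto
    then obtain y where y: "x = int p ^ (k - n) * y" by (elim dvdE)
    have pos: "0 < int p ^ (k - n)" using p by simp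
    have "0 \<le> int p ^ (k - n) * y" "int p ^ (k - n) * y < int p ^ (k - n) * int (p ^ n)"
      using x y split by auto
    hence "y \<in> {0..<int (p ^ n)}"
      using pos by (simp only: zero_le_mult_iff mult_less_cancel_left_pos) auto
    with y show "x \<in> (\<lambda>y. int p ^ (k - n) * y) ` {0..<int (p ^ n)}" by blast
  next
    fix x assume "x \<in> (\<lambda>y. int p ^ (k - n) * y) ` {0..<int (p ^ n)}"
    then obtain y where y: "x = int p ^ (k - n) * y" "y \<in> {0..<int (p ^ n)}" by blast
    have pos: "0 < int p ^ (k - n)" using p by simp
    have x: "x \<in> {0..<int (p ^ k)}"
      using y pos unfolding split by simp
    moreover have "r \<in> {k - n..<k}" if "x \<noteq> 0" "\<not> int p dvd u" "x = int p ^ r * u" for r u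
    proof -
      \<comment> \<open>As \<open>p\<close> does not divide \<open>u\<close>, \<open>r\<close> is
        the valuation of \<open>x\<close>: divisibility by \<open>p ^ (k - n)\<close> bounds it
        below, and \<open>x < p ^ k\<close> bounds it above.\<close>
      have mult: "multiplicity (int p) x = r"
        using that p by (intro multiplicity_eqI) (auto simp: mult.commute[of "int p"])
      have "k - n \<le> r"
        unfolding mult[symmetric] using y that p by (intro multiplicity_geI) auto
      moreover have "0 < x"
        using x that(1) by simp
      with that(3) have "int p ^ r \<le> x"
        by (intro zdvd_imp_le) simp_all
      hence "int p ^ r < int p ^ k"
        using x by auto
      hence "r < k" using p by simp
      ultimately show ?thesis by simp
    qed
    ultimately show "x \<in> ?X" by blast
  qed
  moreover have "inj_on (\<lambda>y. int p ^ (k - n) * y) {0..<int (p ^ n)}"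
    using p by (auto simp: inj_on_def)
  ultimately show ?thesis
    by (simp add: card_image del: of_nat_power)
qed

text \<open>Double counting of the pairs of a position \<open>i\<close> and an
  \<open>x \<in> J\<close> with \<open>snd x = lam ! i\<close>. Summing over positions instead of
  distinct parts is what produces the multiplicities.\<close>

lemma weight_eq_sum_rows:
  assumes "J \<subseteq> fund_poset_of lam"
  shows "weight lam J = (\<Sum>i<length lam. card {r. (r, lam ! i) \<in> J})"
proof -
  have fin: "finite J"
    using assms finite_fund_poset_of finite_subset by blast
  have row: "card {r. (r, k) \<in> J} = (\<Sum>x\<in>J. of_bool (snd x = k))" for k
  proof -
    have "card {r. (r, k) \<in> J} = card ((\<lambda>r. (r, k)) ` {r. (r, k) \<in> J})"
      by (rule card_image[symmetric]) (auto simp: inj_on_def)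
    also have "(\<lambda>r. (r, k)) ` {r. (r, k) \<in> J} = {x \<in> J. snd x = k}"
      by auto
    also have "card \<dots> = (\<Sum>x\<in>J. of_bool (snd x = k))"
      using fin by (simp add: Int_def)
    finally show ?thesis .
  qed
  have "count_list lam k = (\<Sum>i<length lam. of_bool (k = lam ! i))" for k
    by (simp add: count_list_eq_length_filter length_filter_conv_card Int_def)
  thus ?thesis
    unfolding weight_def part_mult_def row by (simp add: sum.swap[of _ J])
qed

lemma card_elem_ideal_of_subset:
  assumes "prime p" "order_ideal (fund_poset_of lam) J"
  shows "card {a \<in> carrier (abelian_p_group p lam). elem_ideal_of p lam a \<subseteq> J} = p ^ weight lam J"
proof -
  define n where "n k = card {r. (r, k) \<in> J}" for k
  define X where "X k = {x \<in> {0..<int (p ^ k)}.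
    \<forall>r u. x \<noteq> 0 \<longrightarrow> \<not> int p dvd u \<longrightarrow> x = int p ^ r * u \<longrightarrow> r \<in> {k - n k..<k}}" for k
  note row = order_ideal_row[OF assms(2), folded n_def]
  \<comment> \<open>Containment in \<open>J\<close> constrains each coordinate on its own, so the
    elements form a product set with factors \<open>X (lam ! i)\<close>.\<close>
  have orbits: "coord_orbits p lam a \<subseteq> J \<longleftrightarrow> (\<forall>i<length lam. \<forall>r u. a i \<noteq> 0 \<longrightarrow>
      \<not> int p dvd u \<longrightarrow> a i = int p ^ r * u \<longrightarrow> r \<in> {lam ! i - n (lam ! i)..<lam ! i})" for a
    unfolding row(2)[OF nth_mem, symmetric] by (auto simp: coord_orbits_def row(2)[symmetric])
  have "{a \<in> carrier (abelian_p_group p lam). elem_ideal_of p lam a \<subseteq> J} =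
      {a \<in> carrier (abelian_p_group p lam). coord_orbits p lam a \<subseteq> J}"
    using elem_ideal_of_subset_iff[OF assms(1) _ assms(2)] by blast
  also have "\<dots> = (\<Pi>\<^sub>E i\<in>{..<length lam}. X (lam ! i))"
    unfolding orbits carrier_abelian_p_group[OF prime_gt_0_nat[OF assms(1)]] X_def PiE_def Pi_def
    by blast
  also have "card \<dots> = (\<Prod>i<length lam. card (X (lam ! i)))"
    by (simp add: card_PiE)
  also have "\<dots> = (\<Prod>i<length lam. p ^ n (lam ! i))"
    unfolding X_def by (intro prod.cong refl card_bounded_valuation assms(1) row(1)) auto
  also have "\<dots> = p ^ (\<Sum>i<length lam. n (lam ! i))"
    by (simp add: power_sum)
  also have "(\<Sum>i<length lam. n (lam ! i)) = weight lam J"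
    using weight_eq_sum_rows assms(2) by (simp add: n_def order_ideal_def)
  finally show ?thesis .
qed

section \<open>Inclusion-exclusion over sets of maximal elements\<close>

theorem theorem8p3:
  fixes p :: nat and lam :: "nat list" and I :: "(nat \<times> nat) set"
  assumes "prime p" and "is_partition lam" and "order_ideal (fund_poset_of lam) I"
  shows "int (card (ideal_orbit p lam I)) =
    (\<Sum>J | order_ideal (fund_poset_of lam) J \<and> I - max_elems I \<subseteq> J \<and> J \<subseteq> I.
       (-1) ^ card (I - J) * int p ^ weight lam J)"
proof -
  define A where "A = carrier (abelian_p_group p lam)"
  define M where "M = max_elems I"
  let ?I = "elem_ideal_of p lam"
  have finA: "finite A"
    using prime_gt_0_nat[OF assms(1)] by (simp add: A_def carrier_abelian_p_group finite_PiE)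
  have MI: "M \<subseteq> I"
    by (auto simp: M_def max_elems_def)
  have "finite I"
    using assms(3) finite_fund_poset_of finite_subset by (auto simp: order_ideal_def)
  hence finM: "finite M"
    using MI finite_subset by blast
  have "(\<Sum>J | order_ideal (fund_poset_of lam) J \<and> I - max_elems I \<subseteq> J \<and> J \<subseteq> I.
       (-1) ^ card (I - J) * int p ^ weight lam J) =
      (\<Sum>S\<in>Pow M. (-1) ^ card (I - (I - S)) * int p ^ weight lam (I - S))"
    unfolding M_def
    by (rule sum.reindex_bij_betw[OF bij_betw_ideals_Pow_max_elems[OF assms(3)], symmetric])
  \<comment> \<open>The power of \<open>p\<close> becomes a count of group elements, written as a
    sum of indicators so that the two sums can be exchanged.\<close>
  also have "\<dots> = (\<Sum>S\<in>Pow M. \<Sum>a\<in>A. (-1) ^ card S * of_bool (?I a \<subseteq> I - S))"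
  proof (rule sum.cong[OF refl])
    fix S assume S: "S \<in> Pow M"
    have "order_ideal (fund_poset_of lam) (I - S)"
      using order_ideal_diff_max_elems[OF assms(3)] S by (simp add: M_def)
    from card_elem_ideal_of_subset[OF assms(1) this]
    have "int p ^ weight lam (I - S) = int (card {a \<in> A. ?I a \<subseteq> I - S})"
      by (simp add: A_def)
    also have "\<dots> = (\<Sum>a\<in>A. of_bool (?I a \<subseteq> I - S))"
      using finA by (simp add: Int_def)
    finally show "(-1) ^ card (I - (I - S)) * int p ^ weight lam (I - S) =
        (\<Sum>a\<in>A. (-1) ^ card S * of_bool (?I a \<subseteq> I - S))"
      using S MI by (simp add: sum_distrib_left double_diff)
  qed
  also have "\<dots> = (\<Sum>a\<in>A. \<Sum>S\<in>Pow M. (-1) ^ card S * of_bool (?I a \<subseteq> I - S))"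
    by (rule sum.swap)
  also have "\<dots> = (\<Sum>a\<in>A. of_bool (?I a = I))"
  proof (rule sum.cong[OF refl])
    fix a
    show "(\<Sum>S\<in>Pow M. (-1) ^ card S * of_bool (?I a \<subseteq> I - S)) = (of_bool (?I a = I) :: int)"
    proof (cases "?I a \<subseteq> I")
      case True
      \<comment> \<open>Given \<open>?I a \<subseteq> I\<close>, the indicator is 1 exactly when
        \<open>S\<close> is disjoint from \<open>?I a\<close>, which leaves the subsets of
        \<open>M - ?I a\<close>.\<close>
      have "(\<Sum>S\<in>Pow M. (-1) ^ card S * of_bool (?I a \<subseteq> I - S)) =
          (\<Sum>S\<in>Pow (M - ?I a). (-1) ^ card S :: int)"
        using finM True by (intro sum.mono_neutral_cong_right) auto
      also have "\<dots> = of_bool (M - ?I a = {})"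
        using finM by (simp add: sum_alternating_Pow)
      also have "M - ?I a = {} \<longleftrightarrow> ?I a = I"
        using order_ideal_eq_iff_max_elems_subset[OF assms(3) order_ideal_elem_ideal_of True]
        by (auto simp: M_def)
      finally show ?thesis .
    next
      case False
      hence "\<not> ?I a \<subseteq> I - S" for S by blast
      with False show ?thesis by auto
    qed
  qed
  also have "\<dots> = int (card (ideal_orbit p lam I))"
    using finA by (simp add: ideal_orbit_def A_def Int_def)
  finally show ?thesis by simp
qed

end
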